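(* Let $(X,d)$ be a distance space and let $\tau(p,\sigma;x,y,z;d)$ be the power triangle function on $(X,d)$, where $x,y,z\in X$ and $(p,\sigma)\in\mathbb{R}^*\times\mathbb{R}^+$. With $\mathbb{R}$ carrying its usual metric $|\cdot|$ and usual order $\le$, the function $\tau(p,\sigma;x,y,z;d)$ is continuous and strictly monotone with respect to the variable $p$, and is continuous and strictly monotone with respect to the variable $\sigma$.
   Context: A distance on a set $X$ is a function $d:X\times X\to\mathbb{R}$ such that for all $x,y\in X$: $d(x,y)\ge 0$; $d(x,y)=0\iff x=y$; $d(x,y)=d(y,x)$ (no triangle inequality is assumed). The pair $(X,d)$ is then a distance space. $\mathbb{R}^*=\mathbb{R}\cup\{-\infty,\infty\}$ and $\mathbb{R}^+$ is the set of positive reals. The power triangle function on $(X,d)$ is $$\tau(p,\sigma;x,y,z;d)=2\sigma\left[\tfrac12 d^p(x,z)+\tfrac12 d^p(z,y)\right]^{1/p},\qquad (p,\sigma)\in\mathbb{R}^*\times\mathbb{R}^+,\ x,y,z\in X,$$ where for $p=\infty,0,-\infty$ the expression is interpreted by its limit in $p$, namely $2\sigma\max\{d(x,z),d(z,y)\}$, $2\sigma\sqrt{d(x,z)}\sqrt{d(z,y)}$, $2\sigma\min\{d(x,z),d(z,y)\}$ respectively, and for $p<0$ with $d(x,z)=0$ or $d(z,y)=0$ it is read as its limiting value $0$.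
   Formalization: Strictness in p is claimed only for d(x,z)≠d(z,y) (on all of R* if both are nonzero, else on [0,∞]), and in σ only if both distances are nonzero, or p>0 and one is nonzero; otherwise τ is constant (e.g. x=y for p, x=y=z for σ). Elsewhere weak monotonicity is proved. *)

theory Defs
  imports "HOL-Analysis.Analysis"
begin

definition distance_space :: "'a set \<Rightarrow> ('a \<Rightarrow> 'a \<Rightarrow> real) \<Rightarrow> bool" where
  "distance_space X d \<longleftrightarrow>
     (\<forall>x\<in>X. \<forall>y\<in>X. 0 \<le> d x y \<and> (d x y = 0 \<longleftrightarrow> x = y) \<and> d x y = d y x)"

text \<open>
  The branch for negative exponents is needed because the library sets \<open>0 powr r = 0\<close> for every
  \<open>r\<close>: the general formula would not give the limiting value 0 when exactly one of the two
  distances vanishes.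
\<close>

definition power_triangle ::
  "ereal \<Rightarrow> real \<Rightarrow> 'a \<Rightarrow> 'a \<Rightarrow> 'a \<Rightarrow> ('a \<Rightarrow> 'a \<Rightarrow> real) \<Rightarrow> real" where
  "power_triangle p \<sigma> x y z d =
     (case p of
        PInfty \<Rightarrow> 2 * \<sigma> * max (d x z) (d z y)
      | MInfty \<Rightarrow> 2 * \<sigma> * min (d x z) (d z y)
      | ereal r \<Rightarrow>
          (if r = 0 then 2 * \<sigma> * sqrt (d x z) * sqrt (d z y)
           else if r < 0 \<and> (d x z = 0 \<or> d z y = 0) then 0
           else 2 * \<sigma> * (1/2 * d x z powr r + 1/2 * d z y powr r) powr (1 / r)))"

text \<open>
  The next two facts record where strict monotonicity breaks down: \<open>power_triangle\<close> does not
  depend on \<open>p\<close> if the two distances agree, and it vanishes for all \<open>p \<le> 0\<close> and all \<open>\<sigma>\<close> if one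
  of them is 0.
\<close>

lemma power_triangle_eq_distances:
  assumes "d x z = d z y" and "0 \<le> d x z"
  shows "power_triangle p \<sigma> x y z d = 2 * \<sigma> * d x z"
  using assms by (cases p) (auto simp: power_triangle_def powr_powr)

lemma power_triangle_zero_distance:
  assumes "d x z = 0 \<or> d z y = 0" and "0 \<le> d x z" and "0 \<le> d z y" and "p \<le> 0"
  shows "power_triangle p \<sigma> x y z d = 0"
  using assms by (cases p) (auto simp: power_triangle_def min_def)

end

theory Submission
  imports Defs "HOL-Real_Asymp.Real_Asymp"
begin

text \<open>
  The power triangle function is \<open>2 * \<sigma>\<close> times the power mean of the two distances. For positive
  distances, written as \<open>exp (c + h)\<close> and \<open>exp (c - h)\<close> with \<open>h > 0\<close>, the mean with exponent \<open>r\<close> is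
  \<open>exp (c + h * L (h * r))\<close>, where \<open>L t = ln (cosh t) / t\<close> extends to a strictly increasing
  continuous function on the extended reals with \<open>L 0 = 0\<close> and \<open>L (\<plusminus>\<infinity>) = \<plusminus>1\<close>. If one distance
  is 0 and the other is \<open>b\<close>, the mean is 0 for \<open>r \<le> 0\<close> and \<open>b * 2 powr (- 1 / r)\<close> for \<open>r > 0\<close>.
\<close>

section \<open>Elementary properties of the power mean\<close>

definition power_mean :: "ereal \<Rightarrow> real \<Rightarrow> real \<Rightarrow> real" where
  "power_mean p a b =
     (case p of
        PInfty \<Rightarrow> max a b
      | MInfty \<Rightarrow> min a b
      | ereal r \<Rightarrow>
          (if r = 0 then sqrt a * sqrt b
           else if r < 0 \<and> (a = 0 \<or> b = 0) then 0
           else (1/2 * a powr r + 1/2 * b powr r) powr (1 / r)))"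

lemma power_mean_simps [simp]:
  "power_mean \<infinity> a b = max a b"
  "power_mean (- \<infinity>) a b = min a b"
  by (simp_all add: power_mean_def)

lemma power_triangle_eq_power_mean:
  "power_triangle p \<sigma> x y z d = 2 * \<sigma> * power_mean p (d x z) (d z y)"
  by (cases p) (auto simp: power_triangle_def power_mean_def)

lemma power_mean_commute: "power_mean p a b = power_mean p b a"
  by (cases p) (auto simp: power_mean_def add.commute max.commute min.commute)

lemma power_mean_same: "0 \<le> a \<Longrightarrow> power_mean p a a = a"
  by (cases p) (auto simp: power_mean_def powr_powr)

lemma power_mean_nonneg: "0 \<le> a \<Longrightarrow> 0 \<le> b \<Longrightarrow> 0 \<le> power_mean p a b"
  by (cases p) (auto simp: power_mean_def)

text \<open>As a function of \<open>\<sigma>\<close>, the power triangle function is linear with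
  slope twice this mean, so positivity is what makes it strictly increasing. For
  \<open>0 < p\<close> a single zero distance is harmless: the sum of the powers, and likewise the
  maximum, stays positive.\<close>

lemma power_mean_pos:
  assumes "0 \<le> a" "0 \<le> b" "a \<noteq> 0 \<and> b \<noteq> 0 \<or> 0 < p \<and> (a \<noteq> 0 \<or> b \<noteq> 0)"
  shows "0 < power_mean p a b"
proof -
  have *: "0 < a powr r + b powr r" for r
    using assms by (metis add_pos_nonneg add_nonneg_pos powr_ge_zero powr_gt_zero)
  have "a powr r / 2 + b powr r / 2 \<noteq> 0" for r
    using *[of r] by linarith
  with assms show ?thesis
    by (cases p) (auto simp: power_mean_def)
qed

section \<open>Continuity and monotonicity on the extended reals from data on the reals\<close>

lemma isCont_ereal_infinityI:
  fixes g :: "ereal \<Rightarrow> 'a::topological_space"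
  assumes "((\<lambda>r. g (ereal r)) \<longlongrightarrow> g \<infinity>) at_top"
  shows "isCont g \<infinity>"
proof -
  \<comment> \<open>No point lies above \<open>\<infinity>\<close>, so a punctured neighbourhood is
    one-sided, and \<open>at_left \<infinity>\<close> is the image of \<open>at_top\<close> under
    \<open>ereal\<close>.\<close>
  have "at (\<infinity>::ereal) = at_left \<infinity>"
    by (simp add: filter_eq_iff eventually_at_filter)
  thus ?thesis
    unfolding isCont_def using assms by (simp add: at_left_PInf filterlim_filtermap)
qed

lemma isCont_ereal_minus_infinityI:
  fixes g :: "ereal \<Rightarrow> 'a::topological_space"
  assumes "((\<lambda>r. g (ereal r)) \<longlongrightarrow> g (-\<infinity>)) at_bot"
  shows "isCont g (-\<infinity>)"
proof -
  have "at (-\<infinity>::ereal) = at_right (-\<infinity>)"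
    by (simp add: filter_eq_iff eventually_at_filter)
  thus ?thesis
    unfolding isCont_def using assms by (simp add: at_right_MInf filterlim_filtermap)
qed

lemma continuous_on_UNIV_erealI:
  fixes g :: "ereal \<Rightarrow> 'a::topological_space"
  assumes "continuous_on UNIV (\<lambda>r. g (ereal r))"
    and "((\<lambda>r. g (ereal r)) \<longlongrightarrow> g \<infinity>) at_top"
    and "((\<lambda>r. g (ereal r)) \<longlongrightarrow> g (-\<infinity>)) at_bot"
  shows "continuous_on UNIV g"
proof -
  have "isCont g p" for p
  proof (cases p)
    case (real r)
    have "isCont (\<lambda>r. g (ereal r)) r"
      using assms(1) by (simp add: continuous_on_eq_continuous_at)
    thus ?thesis
      unfolding isCont_def real by (simp add: at_ereal filterlim_filtermap)
  qed (use assms in \<open>auto intro: isCont_ereal_infinityI isCont_ereal_minus_infinityI\<close>)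
  thus ?thesis
    by (simp add: continuous_on_eq_continuous_at)
qed

lemma strict_mono_on_less_limit_at_top:
  fixes f :: "real \<Rightarrow> real"
  assumes "strict_mono_on {c..} f" "(f \<longlongrightarrow> l) at_top" "c \<le> r"
  shows "f r < l"
proof -
  \<comment> \<open>Passing to the limit preserves only weak inequalities; the intermediate value at
    \<open>r + 1\<close> keeps the bound strict.\<close>
  have "f r < f (r + 1)"
    using assms by (auto intro: strict_mono_onD)
  also have "f (r + 1) \<le> l"
  proof (rule tendsto_lowerbound[OF assms(2)])
    show "eventually (\<lambda>s. f (r + 1) \<le> f s) at_top"
      using eventually_ge_at_top[of "r + 1"]
      by eventually_elim
        (use assms in \<open>auto intro: mono_onD[OF strict_mono_on_imp_mono_on[OF assms(1)]]\<close>)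
  qed simp
  finally show ?thesis .
qed

text \<open>Serves the case of one zero distance, where the mean is constant for nonpositive
  exponents.\<close>

lemma strict_mono_on_nonneg_erealI:
  fixes g :: "ereal \<Rightarrow> real"
  assumes "strict_mono_on {0..} (\<lambda>r. g (ereal r))"
    and "((\<lambda>r. g (ereal r)) \<longlongrightarrow> g \<infinity>) at_top"
  shows "strict_mono_on {0..} g"
proof (rule strict_mono_onI)
  fix p q :: ereal
  assume "p \<in> {0..}" "q \<in> {0..}" "p < q"
  thus "g p < g q"
    using strict_mono_on_less_limit_at_top[OF assms] strict_mono_onD[OF assms(1)]
    by (cases p; cases q) auto
qed

lemma strict_mono_erealI:
  fixes g :: "ereal \<Rightarrow> real"
  assumes mono: "strict_mono (\<lambda>r. g (ereal r))"
    and top: "((\<lambda>r. g (ereal r)) \<longlongrightarrow> g \<infinity>) at_top"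
    and bot: "((\<lambda>r. g (ereal r)) \<longlongrightarrow> g (-\<infinity>)) at_bot"
  shows "strict_mono g"
proof -
  have less_top: "g (ereal r) < g \<infinity>" for r
    using strict_mono_on_less_limit_at_top[OF _ top order_refl] mono
    by (simp add: strict_mono_on_def strict_mono_def)
  \<comment> \<open>Reflecting argument and value turns the limit at \<open>-\<infinity>\<close>
    into one at \<open>\<infinity>\<close> and keeps strict monotonicity, so the same limit bound
    applies.\<close>
  have "((\<lambda>r. - g (ereal (- r))) \<longlongrightarrow> - g (-\<infinity>)) at_top"
    using bot by (intro tendsto_minus) (simp add: at_bot_mirror filterlim_filtermap)
  from strict_mono_on_less_limit_at_top[OF _ this order_refl, of "- r" for r]
  have bot_less: "g (-\<infinity>) < g (ereal r)" for r
    using mono by (force simp: strict_mono_on_def strict_mono_def)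
  show ?thesis
  proof (rule strict_monoI)
    fix p q :: ereal
    assume "p < q"
    thus "g p < g q"
      \<comment> \<open>The last fact compares the two infinities through the value at 0.\<close>
      using less_top bot_less strict_monoD[OF mono] less_trans[OF bot_less[of 0] less_top]
      by (cases p; cases q) auto
  qed
qed

section \<open>The quotient of \<open>ln (cosh t)\<close> by \<open>t\<close>\<close>

text \<open>The value at 0 is 0 since division by 0 yields 0; this is also the limit there.\<close>

definition ln_cosh_quotient :: "real \<Rightarrow> real" where
  "ln_cosh_quotient t = ln (cosh t) / t"

lemma ln_cosh_quotient_minus: "ln_cosh_quotient (- t) = - ln_cosh_quotient t"
  by (simp add: ln_cosh_quotient_def)

lemma tendsto_ln_cosh_quotient_at_top: "(ln_cosh_quotient \<longlongrightarrow> 1) at_top"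
  unfolding ln_cosh_quotient_def cosh_field_def by real_asymp

lemma tendsto_ln_cosh_quotient_at_bot: "(ln_cosh_quotient \<longlongrightarrow> - 1) at_bot"
  unfolding ln_cosh_quotient_def cosh_field_def by real_asymp

lemma continuous_on_ln_cosh_quotient: "continuous_on UNIV ln_cosh_quotient"
proof -
  have "isCont ln_cosh_quotient t" for t
  proof (cases "t = 0")
    case True
    have "((\<lambda>t::real. ln (cosh t) / t) \<longlongrightarrow> 0) (at 0)"
      unfolding cosh_field_def by real_asymp
    thus ?thesis
      by (simp add: True isCont_def ln_cosh_quotient_def[abs_def])
  next
    case False
    thus ?thesis
      unfolding ln_cosh_quotient_def by (intro continuous_intros) auto
  qed
  thus ?thesis
    by (simp add: continuous_on_eq_continuous_at)
qed

text \<open>The difference of the two sides vanishes at 0 and has derivative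
  \<open>s * (1 - tanh s ^ 2)\<close>, which is positive for \<open>s > 0\<close>. Up to the factor
  \<open>1 / t ^ 2\<close> it is the derivative of \<open>ln_cosh_quotient\<close>.\<close>

lemma ln_cosh_less_mult_tanh:
  fixes t :: real
  assumes "0 < t"
  shows "ln (cosh t) < t * tanh t"
proof -
  have "0 * tanh 0 - ln (cosh 0) < t * tanh t - ln (cosh t)"
  proof (rule DERIV_pos_imp_increasing_open[OF assms])
    fix s :: real
    assume "0 < s" "s < t"
    have "((\<lambda>s. s * tanh s - ln (cosh s)) has_real_derivative s * (1 - tanh s ^ 2)) (at s)"
      by (auto intro!: derivative_eq_intros simp: tanh_def[of s])
    moreover have "0 < s * (1 - tanh s ^ 2)"
      using \<open>0 < s\<close> tanh_real_bounds[of s] by (simp add: abs_square_less_1 abs_less_iff)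
    ultimately show "\<exists>y. ((\<lambda>s. s * tanh s - ln (cosh s)) has_real_derivative y) (at s) \<and> 0 < y"
      by blast
  qed (auto intro!: continuous_intros)
  thus ?thesis
    by simp
qed

lemma ln_cosh_quotient_strict_mono_nonneg:
  assumes "0 \<le> s" "s < t"
  shows "ln_cosh_quotient s < ln_cosh_quotient t"
\<comment> \<open>The derivative is needed only inside the interval; continuity covers the endpoint
  \<open>s = 0\<close>, where the quotient rule fails.\<close>
proof (rule DERIV_pos_imp_increasing_open[OF assms(2)])
  fix u assume "s < u" "u < t"
  hence "0 < u"
    using assms by simp
  have "(ln_cosh_quotient has_real_derivative (u * tanh u - ln (cosh u)) / u ^ 2) (at u)"
    unfolding ln_cosh_quotient_def using \<open>0 < u\<close>
    by (auto intro!: derivative_eq_intros simp: tanh_def power2_eq_square)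
  moreover have "0 < (u * tanh u - ln (cosh u)) / u ^ 2"
    using ln_cosh_less_mult_tanh[OF \<open>0 < u\<close>] \<open>0 < u\<close> by simp
  ultimately show "\<exists>y. (ln_cosh_quotient has_real_derivative y) (at u) \<and> 0 < y"
    by blast
qed (rule continuous_on_subset[OF continuous_on_ln_cosh_quotient], simp)

lemma strict_mono_ln_cosh_quotient: "strict_mono ln_cosh_quotient"
proof (rule strict_monoI)
  fix s t :: real
  assume "s < t"
  have zero: "ln_cosh_quotient 0 = 0"
    by (simp add: ln_cosh_quotient_def)
  \<comment> \<open>The function is odd, so the negative half-line follows by reflection; for
    arguments of opposite sign the values are separated by 0.\<close>
  consider "0 \<le> s" | "t \<le> 0" | "s < 0" "0 < t"
    by linarith
  thus "ln_cosh_quotient s < ln_cosh_quotient t"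
  proof cases
    case 2
    thus ?thesis
      using ln_cosh_quotient_strict_mono_nonneg[of "- t" "- s"] \<open>s < t\<close>
      by (simp add: ln_cosh_quotient_minus)
  next
    case 3
    thus ?thesis
      using ln_cosh_quotient_strict_mono_nonneg[of 0 "- s"]
        ln_cosh_quotient_strict_mono_nonneg[of 0 t]
      by (simp add: ln_cosh_quotient_minus zero)
  qed (use \<open>s < t\<close> ln_cosh_quotient_strict_mono_nonneg in auto)
qed

section \<open>The mean of two distinct positive distances\<close>

text \<open>Factoring \<open>exp (c * r)\<close> out of the averaged powers leaves
  \<open>cosh (h * r)\<close>; taking the root divides the logarithm by \<open>r\<close>. At
  \<open>r = 0\<close> the geometric mean is \<open>exp c\<close>, in agreement with
  \<open>ln_cosh_quotient 0 = 0\<close>.\<close>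

lemma power_mean_ereal_eq_exp:
  fixes c h r :: real
  shows "power_mean (ereal r) (exp (c + h)) (exp (c - h)) =
    exp (c + h * ln_cosh_quotient (h * r))"
proof (cases "r = 0")
  case True
  have "exp (c + h) * exp (c - h) = exp c ^ 2"
    by (simp add: power2_eq_square flip: exp_add)
  thus ?thesis
    by (simp add: True power_mean_def ln_cosh_quotient_def flip: real_sqrt_mult)
next
  case False
  have "1/2 * exp (c + h) powr r + 1/2 * exp (c - h) powr r = exp (c * r) * cosh (h * r)"
    by (simp add: powr_def cosh_def algebra_simps flip: exp_add)
  also have "\<dots> = exp (c * r + ln (cosh (h * r)))"
    by (simp add: exp_add cosh_real_pos)
  finally have "1/2 * exp (c + h) powr r + 1/2 * exp (c - h) powr r =
    exp (c * r + ln (cosh (h * r)))" .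
  moreover have "(c * r + ln (cosh (h * r))) / r = c + h * ln_cosh_quotient (h * r)"
    using False by (simp add: ln_cosh_quotient_def field_simps)
  ultimately show ?thesis
    using False by (simp add: power_mean_def powr_def)
qed

lemma power_mean_exp:
  fixes c h :: real
  assumes "0 < h"
  defines "g \<equiv> \<lambda>p. power_mean p (exp (c + h)) (exp (c - h))"
  shows "continuous_on UNIV g" "strict_mono g"
proof -
  have g: "(\<lambda>r. g (ereal r)) = (\<lambda>r. exp (c + h * ln_cosh_quotient (h * r)))"
    by (simp add: g_def power_mean_ereal_eq_exp)
  \<comment> \<open>As \<open>h > 0\<close>, the limits 1 and -1 of \<open>ln_cosh_quotient\<close>
    produce \<open>exp (c + h)\<close> and \<open>exp (c - h)\<close>, the maximum and minimum of
    the two distances.\<close>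
  have "((\<lambda>r. exp (c + h * ln_cosh_quotient (h * r))) \<longlongrightarrow> exp (c + h * 1)) at_top"
    by (intro tendsto_intros filterlim_compose[OF tendsto_ln_cosh_quotient_at_top]
        filterlim_tendsto_pos_mult_at_top[OF tendsto_const assms(1)] filterlim_ident)
  hence top: "((\<lambda>r. g (ereal r)) \<longlongrightarrow> g \<infinity>) at_top"
    unfolding g using assms(1) by (simp add: g_def)
  have "((\<lambda>r. exp (c + h * ln_cosh_quotient (h * r))) \<longlongrightarrow> exp (c + h * - 1)) at_bot"
    by (intro tendsto_intros filterlim_compose[OF tendsto_ln_cosh_quotient_at_bot]
        filterlim_tendsto_pos_mult_at_bot[OF tendsto_const assms(1)] filterlim_ident)
  hence bot: "((\<lambda>r. g (ereal r)) \<longlongrightarrow> g (-\<infinity>)) at_bot"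
    unfolding g using assms(1) by (simp add: g_def)
  have "continuous_on UNIV (\<lambda>r. g (ereal r))"
    unfolding g
    by (intro continuous_intros continuous_on_compose2[OF continuous_on_ln_cosh_quotient]) auto
  from this top bot show "continuous_on UNIV g"
    by (rule continuous_on_UNIV_erealI)
  have "strict_mono (\<lambda>r. g (ereal r))"
    unfolding g using assms(1) strict_monoD[OF strict_mono_ln_cosh_quotient]
    by (intro strict_monoI) simp
  from this top bot show "strict_mono g"
    by (rule strict_mono_erealI)
qed

lemma power_mean_positive:
  assumes "0 < a" "0 < b" "a \<noteq> b"
  shows "continuous_on UNIV (\<lambda>p. power_mean p a b)" "strict_mono (\<lambda>p. power_mean p a b)"
proof -
  have *: "continuous_on UNIV (\<lambda>p. power_mean p a b) \<and> strict_mono (\<lambda>p. power_mean p a b)"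
    if "0 < b" "b < a" for a b :: real
  proof -
    \<comment> \<open>Solves \<open>exp (c + h) = a\<close> and \<open>exp (c - h) = b\<close>; the
      order \<open>b < a\<close> makes \<open>h\<close> positive.\<close>
    define c h where "c = (ln a + ln b) / 2" and "h = (ln a - ln b) / 2"
    have "c + h = ln a" "c - h = ln b" "0 < h"
      using that by (simp_all add: c_def h_def field_simps)
    thus ?thesis
      using power_mean_exp[of h c] that by simp
  qed
  show "continuous_on UNIV (\<lambda>p. power_mean p a b)" "strict_mono (\<lambda>p. power_mean p a b)"
    using *[of a b] *[of b a] assms power_mean_commute[of _ a b] by (auto simp: neq_iff)
qed

section \<open>The mean when one distance vanishes\<close>

lemma power_mean_zero_nonpos: "0 \<le> b \<Longrightarrow> p \<le> 0 \<Longrightarrow> power_mean p 0 b = 0"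
  by (cases p) (auto simp: power_mean_def)

lemma power_mean_zero_pos:
  assumes "0 \<le> b" "0 < r"
  shows "power_mean (ereal r) 0 b = b * 2 powr (- 1 / r)"
proof -
  have "power_mean (ereal r) 0 b = (b powr r / 2) powr (1 / r)"
    using assms by (simp add: power_mean_def)
  also have "\<dots> = b / 2 powr (1 / r)"
    using assms by (simp add: powr_divide powr_powr)
  also have "\<dots> = b * 2 powr (- 1 / r)"
    using powr_minus_divide[of 2 "1 / r"] by simp
  finally show ?thesis .
qed

lemma power_mean_zero:
  assumes "0 < b"
  shows "continuous_on UNIV (\<lambda>p. power_mean p 0 b)"
    and "strict_mono_on {0..} (\<lambda>p. power_mean p 0 b)"
    and "mono (\<lambda>p. power_mean p 0 b)"
proof -
  define f where "f r = power_mean (ereal r) 0 b" for r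
  have nonpos: "f r = 0" if "r \<le> 0" for r
    using that assms by (simp add: f_def power_mean_zero_nonpos)
  have pos: "f r = b * 2 powr (- 1 / r)" if "0 < r" for r
    using that assms by (simp add: f_def power_mean_zero_pos)
  have "((\<lambda>r::real. b * 2 powr (- 1 / r)) \<longlongrightarrow> b) at_top"
    by real_asymp
  moreover have "eventually (\<lambda>r. b * 2 powr (- 1 / r) = f r) at_top"
    using eventually_gt_at_top[of 0] by eventually_elim (simp add: pos)
  ultimately have top: "(f \<longlongrightarrow> power_mean \<infinity> 0 b) at_top"
    using assms by (auto intro: Lim_transform_eventually)
  have "eventually (\<lambda>r. f r = 0) at_bot"
    using eventually_le_at_bot[of 0] by eventually_elim (simp add: nonpos)
  hence bot: "(f \<longlongrightarrow> power_mean (- \<infinity>) 0 b) at_bot"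
    using assms by (simp add: tendsto_eventually)
  have "isCont f r" for r
  proof -
    consider "r < 0" | "r = 0" | "0 < r"
      by linarith
    thus ?thesis
    proof cases
      case 1
      hence "eventually (\<lambda>s. f s = 0) (nhds r)"
        using eventually_nhds_in_open[of "{..<0}" r] by (auto elim!: eventually_mono intro: nonpos)
      from isCont_cong[OF this] show ?thesis
        by simp
    next
      case 2
      \<comment> \<open>The two formulas meet at 0: from the right the exponent
        \<open>- 1 / r\<close> tends to \<open>-\<infinity>\<close>, so the mean tends to its
        constant value 0 on the left.\<close>
      have "((\<lambda>r::real. b * 2 powr (- 1 / r)) \<longlongrightarrow> 0) (at_right 0)"
        by real_asymp
      hence "(f \<longlongrightarrow> 0) (at_right 0)"
        by (rule Lim_transform_eventually) (auto simp: eventually_at_filter pos)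
      moreover have "(f \<longlongrightarrow> 0) (at_left 0)"
        by (rule tendsto_eventually) (auto simp: eventually_at_filter nonpos)
      ultimately show ?thesis
        by (simp add: 2 isCont_def nonpos filterlim_split_at)
    next
      case 3
      hence ev: "eventually (\<lambda>s. f s = b * 2 powr (- 1 / s)) (nhds r)"
        using eventually_nhds_in_open[of "{0<..}" r] by (auto elim!: eventually_mono simp: pos)
      have "isCont (\<lambda>s. b * 2 powr (- 1 / s)) r"
        using 3 by (intro continuous_intros) auto
      thus ?thesis
        using isCont_cong[OF ev] by simp
    qed
  qed
  hence "continuous_on UNIV f"
    by (simp add: continuous_on_eq_continuous_at)
  thus "continuous_on UNIV (\<lambda>p. power_mean p 0 b)"
    using top bot unfolding f_def by (rule continuous_on_UNIV_erealI)
  have "strict_mono_on {0..} f"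
  proof (rule strict_mono_onI)
    fix r s :: real
    assume "r \<in> {0..}" "s \<in> {0..}" "r < s"
    thus "f r < f s"
      \<comment> \<open>From \<open>r = 0\<close> the value jumps from 0 to something positive; for
        \<open>r > 0\<close> the exponent \<open>- 1 / r\<close> is strictly increasing.\<close>
      using assms by (cases "r = 0") (auto simp: nonpos pos frac_less2)
  qed
  thus strict: "strict_mono_on {0..} (\<lambda>p. power_mean p 0 b)"
    using top unfolding f_def by (rule strict_mono_on_nonneg_erealI)
  show "mono (\<lambda>p. power_mean p 0 b)"
  proof (rule monoI)
    fix p q :: ereal
    assume "p \<le> q"
    show "power_mean p 0 b \<le> power_mean q 0 b"
    \<comment> \<open>If \<open>p \<le> 0\<close> the left side is 0 and the right side nonnegative;
      otherwise both exponents lie in the range of strict monotonicity.\<close>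
    proof (cases "p \<le> 0")
      case True
      thus ?thesis
        using assms by (simp add: power_mean_zero_nonpos power_mean_nonneg)
    next
      case False
      thus ?thesis
        using \<open>p \<le> q\<close> mono_onD[OF strict_mono_on_imp_mono_on[OF strict], of p q] by auto
    qed
  qed
qed

section \<open>Arbitrary nonnegative distances and the power triangle function\<close>

lemma power_mean_exponent:
  assumes "0 \<le> a" "0 \<le> b"
  shows continuous_on_power_mean: "continuous_on UNIV (\<lambda>p. power_mean p a b)"
    and mono_power_mean: "mono (\<lambda>p. power_mean p a b)"
    and strict_mono_on_power_mean: "a \<noteq> b \<Longrightarrow> strict_mono_on {0..} (\<lambda>p. power_mean p a b)"
proof -
  consider "a = b" | "0 < a" "0 < b" "a \<noteq> b" | "a = 0" "0 < b" | "0 < a" "b = 0"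
    using assms by fastforce
  hence "continuous_on UNIV (\<lambda>p. power_mean p a b) \<and> mono (\<lambda>p. power_mean p a b) \<and>
    (a \<noteq> b \<longrightarrow> strict_mono_on {0..} (\<lambda>p. power_mean p a b))"
  proof cases
    case 1
    thus ?thesis
      using assms by (simp add: power_mean_same monoI)
  next
    case 2
    thus ?thesis
      using power_mean_positive[of a b]
      by (auto intro: strict_mono_mono simp: strict_mono_on_def strict_mono_def)
  next
    case 3
    thus ?thesis
      using power_mean_zero[of b] by simp
  next
    case 4
    thus ?thesis
      using power_mean_zero[of a] by (simp add: power_mean_commute[of _ a])
  qed
  thus "continuous_on UNIV (\<lambda>p. power_mean p a b)" "mono (\<lambda>p. power_mean p a b)"
    "a \<noteq> b \<Longrightarrow> strict_mono_on {0..} (\<lambda>p. power_mean p a b)"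
    by auto
qed

theorem corollary4p6:
  fixes X :: "'a set" and d :: "'a \<Rightarrow> 'a \<Rightarrow> real" and x y z :: 'a
  assumes "distance_space X d" and "x \<in> X" and "y \<in> X" and "z \<in> X"
  shows
    "(\<forall>\<sigma>>0.
        continuous_on UNIV (\<lambda>p::ereal. power_triangle p \<sigma> x y z d) \<and>
        mono (\<lambda>p::ereal. power_triangle p \<sigma> x y z d) \<and>
        (d x z \<noteq> d z y \<longrightarrow>
           strict_mono_on {0..} (\<lambda>p::ereal. power_triangle p \<sigma> x y z d)) \<and>
        (d x z \<noteq> d z y \<and> x \<noteq> z \<and> z \<noteq> y \<longrightarrow>
           strict_mono (\<lambda>p::ereal. power_triangle p \<sigma> x y z d))) \<and>
     (\<forall>p::ereal.
        continuous_on {0<..} (\<lambda>\<sigma>. power_triangle p \<sigma> x y z d) \<and>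
        mono_on {0<..} (\<lambda>\<sigma>. power_triangle p \<sigma> x y z d) \<and>
        (x \<noteq> z \<and> z \<noteq> y \<or> 0 < p \<and> (x \<noteq> z \<or> z \<noteq> y) \<longrightarrow>
           strict_mono_on {0<..} (\<lambda>\<sigma>. power_triangle p \<sigma> x y z d)))"
proof -
  define a b where "a = d x z" and "b = d z y"
  \<comment> \<open>In a distance space, distinctness of points is nonvanishing of distances, so all
    the side conditions become conditions on \<open>a\<close> and \<open>b\<close>.\<close>
  have ab: "0 \<le> a" "0 \<le> b" "x \<noteq> z \<longleftrightarrow> a \<noteq> 0" "z \<noteq> y \<longleftrightarrow> b \<noteq> 0"
    using assms by (auto simp: distance_space_def a_def b_def)
  have eq: "power_triangle p \<sigma> x y z d = 2 * \<sigma> * power_mean p a b" for p \<sigma>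
    by (simp add: power_triangle_eq_power_mean a_def b_def)
  show ?thesis
    unfolding eq ab(3,4) a_def[symmetric] b_def[symmetric]
  proof (intro conjI allI impI)
    fix \<sigma> :: real
    assume "0 < \<sigma>"
    show "continuous_on UNIV (\<lambda>p. 2 * \<sigma> * power_mean p a b)"
      by (intro continuous_intros continuous_on_power_mean ab)
    show "mono (\<lambda>p. 2 * \<sigma> * power_mean p a b)"
      using \<open>0 < \<sigma>\<close> monoD[OF mono_power_mean[OF ab(1,2)]] by (simp add: monoI)
    show "strict_mono_on {0..} (\<lambda>p. 2 * \<sigma> * power_mean p a b)" if "a \<noteq> b"
      using \<open>0 < \<sigma>\<close> strict_mono_on_power_mean[OF ab(1,2) that] by (simp add: strict_mono_on_def)
    show "strict_mono (\<lambda>p. 2 * \<sigma> * power_mean p a b)" if "a \<noteq> b \<and> a \<noteq> 0 \<and> b \<noteq> 0"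
      using \<open>0 < \<sigma>\<close> power_mean_positive(2)[of a b] that ab(1,2) by (simp add: strict_mono_def)
  next
    fix p :: ereal
    show "continuous_on {0<..} (\<lambda>\<sigma>. 2 * \<sigma> * power_mean p a b)"
      by (intro continuous_intros)
    show "mono_on {0<..} (\<lambda>\<sigma>. 2 * \<sigma> * power_mean p a b)"
      using power_mean_nonneg[OF ab(1,2)] by (intro mono_onI mult_right_mono) auto
    show "strict_mono_on {0<..} (\<lambda>\<sigma>. 2 * \<sigma> * power_mean p a b)"
      if "a \<noteq> 0 \<and> b \<noteq> 0 \<or> 0 < p \<and> (a \<noteq> 0 \<or> b \<noteq> 0)"
      using power_mean_pos[OF ab(1,2) that] by (intro strict_mono_onI) simp
  qed
qed

end
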